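(* Let $d\ge1$, $n\ge1$, let $X=\{x_1,\dots,x_n\}\subset\mathbb{R}^d$ be distinct points and $m\colon\mathbb{R}^d\to\mathbb{R}$ a function. Let $K(x,y)=\Phi(x-y)$, $x,y\in\mathbb{R}^d$, be a positive-definite kernel, where $\Phi\colon\mathbb{R}^d\to\mathbb{R}$ is continuous and integrable and there are constants $C_1,C_2>0$ and $\alpha>d/2$ such that $C_1(1+\|\xi\|^2)^{-\alpha}\le\widehat\Phi(\xi)\le C_2(1+\|\xi\|^2)^{-\alpha}$ for all $\xi\in\mathbb{R}^d$. Let $p$ be a probability density function on $(0,\infty)$ (the hyperprior for the lengthscale) such that $$\lambda^{(\alpha-d/2)n}p(\lambda)\to0\quad\text{as}\quad\lambda\to\infty.$$ For $Y=(y_1,\dots,y_n)\in\mathbb{R}^n$, with $Y_m=(y_i-m(x_i))_{i=1}^n$ and $K_\lambda(x,y)=\Phi((x-y)/\lambda)$, define for $\lambda>0$ $$\ell_{\mathrm{MAP}}(\lambda\mid Y)=\frac12\Big(Y_m^{\mathsf T}K_\lambda(X,X)^{-1}Y_m+\log\det K_\lambda(X,X)\Big)-\log p(\lambda),$$ and let $\lambda_{\mathrm{MAP}}\in\arg\min_{\lambda>0}\ell_{\mathrm{MAP}}(\lambda\mid Y)$. Then, for any data $Y\in\mathbb{R}^n$, $$\lim_{\lambda\to\infty}\ell_{\mathrm{MAP}}(\lambda\mid Y)=\infty\quad\text{and}\quad\lambda_{\mathrm{MAP}}<\infty.$$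
   Context: A kernel is a symmetric function $K\colon\mathbb{R}^d\times\mathbb{R}^d\to\mathbb{R}$; it is (strictly) positive-definite if $\sum_{i,j}a_ia_jK(z_i,z_j)>0$ for all $N\in\mathbb{N}$, all non-zero $a\in\mathbb{R}^N$ and all distinct $z_1,\dots,z_N$. $K_\lambda(X,X)=(K_\lambda(x_i,x_j))_{i,j=1}^n$. The Fourier transform is $\widehat f(\xi)=\int_{\mathbb{R}^d}f(x)e^{-\mathrm{i}\xi^{\mathsf T}x}\,dx$. We set $-\log0=+\infty$. Convention: $\lambda_{\mathrm{MAP}}<\infty$ means that every sequence $(\lambda_k)$ in $(0,\infty)$ with $\ell_{\mathrm{MAP}}(\lambda_k\mid Y)\to\inf_{\lambda>0}\ell_{\mathrm{MAP}}(\lambda\mid Y)$ is bounded. *)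

theory Defs
  imports "HOL-Analysis.Analysis"
begin

definition pos_def_kernel :: "('a \<Rightarrow> 'a \<Rightarrow> real) \<Rightarrow> bool" where
  "pos_def_kernel K \<longleftrightarrow>
     (\<forall>x y. K x y = K y x) \<and>
     (\<forall>(N::nat) (a::nat \<Rightarrow> real) z.
        (\<exists>i<N. a i \<noteq> 0) \<and> inj_on z {..<N} \<longrightarrow>
        (\<Sum>i<N. \<Sum>j<N. a i * a j * K (z i) (z j)) > 0)"

definition fourier :: "(real^'d \<Rightarrow> real) \<Rightarrow> real^'d \<Rightarrow> complex" where
  "fourier f \<xi> = (\<integral>x. of_real (f x) * exp (- (\<i> * of_real (\<xi> \<bullet> x))) \<partial>lborel)"

text \<open>The Fourier transform of an even function is real, so bounds on it may be stated for its
  real part.\<close>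

lemma fourier_even_real:
  fixes f :: "real^'d \<Rightarrow> real"
  assumes even: "\<And>x. f (- x) = f x"
  shows "fourier f \<xi> \<in> \<real>"
proof -
  let ?g = "\<lambda>x. complex_of_real (f x) * exp (- (\<i> * of_real (\<xi> \<bullet> x)))"
  have refl: "distr lborel borel uminus = (lborel :: (real^'d) measure)"
    using lborel_affine[of "-1" "0 :: real^'d"] by (simp add: density_1)
  have "cnj (fourier f \<xi>) = (\<integral>x. cnj (?g x) \<partial>lborel)"
    unfolding fourier_def by (rule Bochner_Integration.integral_cnj[symmetric])
  also have "\<dots> = (\<integral>x. ?g (- x) \<partial>lborel)"
    by (intro Bochner_Integration.integral_cong) (auto simp: even exp_cnj)
  also have "\<dots> = fourier f \<xi>"
  proof (cases "?g \<in> borel_measurable borel")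
    case True
    then show ?thesis
      unfolding fourier_def
      using integral_distr[of uminus lborel borel ?g] by (simp add: refl)
  next
    case False
    have "\<not> integrable lborel ?g"
      using False by auto
    moreover have "\<not> integrable lborel (\<lambda>x. ?g (- x))"
    proof
      assume "integrable lborel (\<lambda>x. ?g (- x))"
      then have "(\<lambda>x. ?g (- x)) \<in> borel_measurable borel"
        by auto
      from measurable_compose[OF _ this, of uminus borel] show False
        using False by simp
    qed
    ultimately show ?thesis
      unfolding fourier_def by (simp add: not_integrable_integral_eq)
  qed
  finally show ?thesis
    by (simp add: Reals_cnj_iff)
qed

definition pdf_on_pos :: "(real \<Rightarrow> real) \<Rightarrow> bool" where
  "pdf_on_pos p \<longleftrightarrow>
     (\<forall>l>0. 0 \<le> p l) \<and> set_integrable lebesgue {0<..} p \<and> (LINT l:{0<..}|lebesgue. p l) = 1"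

text \<open>The extended-real \<open>-log t\<close>, with the convention \<open>-log 0 = \<infinity>\<close>; only used
  for \<open>t \<ge> 0\<close>.\<close>

definition neg_log :: "real \<Rightarrow> ereal" where
  "neg_log t = (if t = 0 then \<infinity> else ereal (- ln t))"

definition scaled_kernel :: "(real^'d \<Rightarrow> real) \<Rightarrow> real \<Rightarrow> real^'d \<Rightarrow> real^'d \<Rightarrow> real" where
  "scaled_kernel \<Phi> l x y = \<Phi> ((x - y) /\<^sub>R l)"

definition kernel_matrix :: "('a \<Rightarrow> 'a \<Rightarrow> real) \<Rightarrow> ('n \<Rightarrow> 'a) \<Rightarrow> real^'n^'n" where
  "kernel_matrix K X = (\<chi> i j. K (X i) (X j))"

definition residual :: "(real^'d \<Rightarrow> real) \<Rightarrow> ('n \<Rightarrow> real^'d) \<Rightarrow> real^'n \<Rightarrow> real^'n" where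
  "residual m X Y = (\<chi> i. Y $ i - m (X i))"

definition l_MAP ::
  "(real^'d \<Rightarrow> real) \<Rightarrow> (real^'d \<Rightarrow> real) \<Rightarrow> (real \<Rightarrow> real) \<Rightarrow> ('n::finite \<Rightarrow> real^'d) \<Rightarrow> real^'n \<Rightarrow> real \<Rightarrow> ereal"
where
  "l_MAP \<Phi> m p X Y l =
     (let A = kernel_matrix (scaled_kernel \<Phi> l) X; r = residual m X Y
      in ereal (1 / 2 * (r \<bullet> (matrix_inv A *v r) + ln (det A))) + neg_log (p l))"

text \<open>The meaning of ``\<open>\<lambda>\<^sub>M\<^sub>A\<^sub>P < \<infinity>\<close>'' for an objective on \<open>(0,\<infinity>)\<close>: every minimising sequence is
  bounded. The infimum and the convergence are in the extended reals.\<close>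

definition argmin_finite :: "(real \<Rightarrow> ereal) \<Rightarrow> bool" where
  "argmin_finite f \<longleftrightarrow>
     (\<forall>s::nat \<Rightarrow> real. (\<forall>k. 0 < s k) \<and> (\<lambda>k. f (s k)) \<longlonglongrightarrow> (INF l\<in>{0<..}. f l) \<longrightarrow>
        bounded (range s))"

end

theory Submission
  imports Defs "HOL-Probability.Characteristic_Functions" "HOL-Real_Asymp.Real_Asymp"
begin

text \<open>The quadratic term of the objective is nonnegative, so everything rests on how fast
  \<open>det K\<^sub>\<lambda>(X,X)\<close> can shrink as \<open>\<lambda> \<rightarrow> \<infinity>\<close>. The claim is that for \<open>\<lambda> \<ge> 1\<close> the matrix dominates
  \<open>c \<lambda>\<^bsup>d - 2\<alpha>\<^esup>\<close> times the identity (\<open>scaled_kernel_matrix_coercive\<close>). Then its determinant is at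
  least a constant times \<open>\<lambda>\<^bsup>(d - 2\<alpha>)n\<^esup>\<close> (\<open>det_ge_of_coercive\<close>), and the objective is at least
  \<open>b - log (\<lambda>\<^bsup>(\<alpha> - d/2)n\<^esup> p(\<lambda>))\<close> for a constant \<open>b\<close>, which tends to infinity by the tail condition
  on the hyperprior. Since \<open>p\<close> is positive somewhere, the infimum of the objective is not
  \<open>\<infinity>\<close>, and a minimising sequence cannot have a subsequence that runs off to infinity
  (\<open>argmin_finite_of_tendsto_infinity\<close>).

  The coercivity comes from comparing \<open>\<Phi>\<close> with a Gaussian. If the Fourier transform of \<open>\<Phi>\<close>
  dominates that of a multiple of a Gaussian, then the difference has a nonnegative Fourier
  transform, hence nonnegative quadratic forms (\<open>quadratic_form_ge_gaussian\<close>); this is the easy half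
  of Bochner's theorem. Here the algebraic lower bound on the transform of \<open>\<Phi>\<close> dominates
  a constant times \<open>\<lambda>\<^bsup>-2\<alpha>\<^esup> exp (- |\<xi>|\<^sup>2 / (2 t\<^sup>2 \<lambda>\<^sup>2))\<close>, whose inverse transform is a Gaussian of width
  \<open>1 / (t \<lambda>)\<close> and height proportional to \<open>\<lambda>\<^bsup>d - 2\<alpha>\<^esup>\<close>. Evaluated at the points \<open>x\<^sub>i / \<lambda>\<close>
  its Gram matrix depends on \<open>t\<close> and the \<open>x\<^sub>i\<close> only, up to that height, and if \<open>t\<close> is large it is
  diagonally dominant because the \<open>x\<^sub>i\<close> are distinct (\<open>narrow_gaussian_gram_ge\<close>).\<close>

section \<open>Gaussians and their Fourier transforms\<close>

lemma
  fixes f :: "'a::euclidean_space \<Rightarrow> 'b::{banach, second_countable_topology}"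
  assumes c: "c \<noteq> 0" and f[measurable]: "f \<in> borel_measurable borel"
  shows lborel_integral_affine:
      "(\<integral>x. f x \<partial>lborel) = \<bar>c\<bar> ^ DIM('a) *\<^sub>R (\<integral>x. f (t + c *\<^sub>R x) \<partial>lborel)"
    and lborel_integrable_affine:
      "integrable lborel (\<lambda>x. f (t + c *\<^sub>R x)) \<longleftrightarrow> integrable lborel f"
proof -
  have eq: "lborel = density (distr lborel borel (\<lambda>x::'a. t + c *\<^sub>R x)) (\<lambda>_. ennreal (\<bar>c\<bar> ^ DIM('a)))"
    using lborel_affine[OF c, of t] by (simp add: ennreal_power)
  show "(\<integral>x. f x \<partial>lborel) = \<bar>c\<bar> ^ DIM('a) *\<^sub>R (\<integral>x. f (t + c *\<^sub>R x) \<partial>lborel)"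
    by (subst eq) (simp add: integral_density integral_distr)
  show "integrable lborel (\<lambda>x. f (t + c *\<^sub>R x)) \<longleftrightarrow> integrable lborel f"
  proof -
    have "integrable lborel f \<longleftrightarrow> integrable lborel (\<lambda>x. \<bar>c\<bar> ^ DIM('a) *\<^sub>R f (t + c *\<^sub>R x))"
      by (subst eq) (simp add: integrable_density integrable_distr_eq)
    moreover have "integrable lborel (\<lambda>x. f (t + c *\<^sub>R x))"
      if "integrable lborel (\<lambda>x. \<bar>c\<bar> ^ DIM('a) *\<^sub>R f (t + c *\<^sub>R x))"
      using integrable_scaleR_right[of "1 / \<bar>c\<bar> ^ DIM('a)", OF that] c by simp
    ultimately show ?thesis
      by auto
  qed
qed

definition gauss :: "'a::euclidean_space \<Rightarrow> real" where
  "gauss x = (1 / sqrt (2 * pi)) ^ DIM('a) * exp (- (norm x)\<^sup>2 / 2)"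

lemma gauss_0_pos: "0 < gauss (0::'a::euclidean_space)"
  by (simp add: gauss_def)

lemma gauss_nonneg: "0 \<le> gauss x"
  by (simp add: gauss_def)

lemma gauss_divide_gauss_0: "gauss x / gauss (0::'a::euclidean_space) = exp (- (norm (x::'a))\<^sup>2 / 2)"
  by (simp add: gauss_def)

lemma continuous_on_gauss [continuous_intros]:
  "continuous_on S f \<Longrightarrow> continuous_on S (\<lambda>x. gauss (f x))"
  unfolding gauss_def by (intro continuous_intros) auto

lemma borel_measurable_gauss [measurable]: "gauss \<in> borel_measurable borel"
  by (intro borel_measurable_continuous_onI continuous_intros)

lemma exp_norm_eq_prod:
  "exp (- (norm (x::'a::euclidean_space))\<^sup>2 / 2) = (\<Prod>b\<in>Basis. exp (- (x \<bullet> b)\<^sup>2 / 2))"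
proof -
  have "(norm x)\<^sup>2 = (\<Sum>b\<in>Basis. (x \<bullet> b)\<^sup>2)"
    by (subst power2_norm_eq_inner, subst euclidean_inner) (simp add: power2_eq_square)
  then have "- (norm x)\<^sup>2 / 2 = (\<Sum>b\<in>Basis. - (x \<bullet> b)\<^sup>2 / 2)"
    by (simp only: sum_negf sum_divide_distrib[symmetric])
  then show ?thesis
    by (simp only: exp_sum[OF finite_Basis])
qed

lemma gauss_eq_prod: "gauss x = (\<Prod>b\<in>Basis. std_normal_density (x \<bullet> b))"
  unfolding gauss_def std_normal_density_def exp_norm_eq_prod by (simp add: prod.distrib power_divide prod_dividef)

lemma has_bochner_integral_std_normal_iexp:
  "has_bochner_integral lborel (\<lambda>x. complex_of_real (std_normal_density x) * iexp (t * x))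
     (of_real (exp (- t\<^sup>2 / 2)))"
proof -
  interpret real_distribution std_normal_distribution
    by (rule real_dist_normal_dist)
  have "integrable std_normal_distribution (\<lambda>x. iexp (t * x))"
    by (rule integrable_const_bound[where B=1]) auto
  moreover have "(CLINT x|std_normal_distribution. iexp (t * x)) = of_real (exp (- t\<^sup>2 / 2))"
    using char_std_normal_distribution by (simp add: char_def fun_eq_iff)
  ultimately show ?thesis
    by (simp add: has_bochner_integral_iff integrable_density integral_density
        normal_density_nonneg scaleR_conv_of_real)
qed

text \<open>Both factors of the integrand split over the coordinates, so the one-dimensional
  characteristic function and Fubini on the product measure suffice.\<close>

lemma has_bochner_integral_gauss_iexp:
  fixes v :: "'a::euclidean_space"
  shows "has_bochner_integral lborel (\<lambda>x. complex_of_real (gauss x) * iexp (v \<bullet> x))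
    (of_real (exp (- (norm v)\<^sup>2 / 2)))"
proof -
  interpret product_sigma_finite "\<lambda>_::'a. lborel :: real measure" ..
  let ?f = "\<lambda>b x. complex_of_real (std_normal_density x) * iexp ((v \<bullet> b) * x)"
  let ?g = "\<lambda>x::'a. complex_of_real (gauss x) * iexp (v \<bullet> x)"
  let ?T = "\<lambda>f. \<Sum>b\<in>Basis. f b *\<^sub>R (b::'a)"
  have f: "integrable lborel (?f b)" "integral\<^sup>L lborel (?f b) = of_real (exp (- (v \<bullet> b)\<^sup>2 / 2))" for b
    using has_bochner_integral_std_normal_iexp[of "v \<bullet> b"] by (simp_all add: has_bochner_integral_iff)
  have g: "?g (?T x) = (\<Prod>b\<in>Basis. ?f b (x b))" for x
    by (simp add: gauss_eq_prod inner_sum_right prod.distrib exp_sum sum_distrib_left mult_ac)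
  have [measurable]: "?g \<in> borel_measurable borel"
    by measurable
  have T: "?T \<in> measurable (\<Pi>\<^sub>M b\<in>(Basis::'a set). (lborel::real measure)) borel"
    by measurable
  have "integrable lborel ?g"
    unfolding lborel_eq[where 'a='a] integrable_distr_eq[OF T \<open>?g \<in> borel_measurable borel\<close>] g
    by (intro product_integrable_prod f) auto
  moreover have "integral\<^sup>L lborel ?g = (\<Prod>b\<in>Basis. of_real (exp (- (v \<bullet> b)\<^sup>2 / 2)))"
    unfolding lborel_eq[where 'a='a] integral_distr[OF T \<open>?g \<in> borel_measurable borel\<close>] g
    by (subst product_integral_prod) (auto intro: f(1) simp only: f(2) finite_Basis)
  ultimately show ?thesis
    by (simp only: has_bochner_integral_iff exp_norm_eq_prod of_real_prod simp_thms)
qed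

lemma
  shows integrable_gauss: "integrable lborel (gauss :: 'a::euclidean_space \<Rightarrow> real)"
    and integral_gauss: "integral\<^sup>L lborel (gauss :: 'a::euclidean_space \<Rightarrow> real) = 1"
proof -
  have *: "has_bochner_integral lborel (\<lambda>x::'a. complex_of_real (gauss x)) (of_real 1)"
    using has_bochner_integral_gauss_iexp[of "0::'a"] by simp
  then show "integrable lborel (gauss :: 'a::euclidean_space \<Rightarrow> real)"
    using has_bochner_integral_iff complex_of_real_integrable_eq by blast
  from * show "integral\<^sup>L lborel (gauss :: 'a::euclidean_space \<Rightarrow> real) = 1"
    by (simp add: has_bochner_integral_iff)
qed

lemma
  fixes v :: "'a::euclidean_space"
  assumes s: "s > 0"
  shows integrable_scaled_gauss_iexp:
      "integrable lborel (\<lambda>x::'a. complex_of_real (gauss (s *\<^sub>R x)) * iexp (v \<bullet> x))"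
    and integral_scaled_gauss_iexp:
      "(\<integral>x. complex_of_real (gauss (s *\<^sub>R x)) * iexp (v \<bullet> x) \<partial>lborel) =
         of_real (exp (- (norm (v /\<^sub>R s))\<^sup>2 / 2) / s ^ DIM('a))"
proof -
  let ?f = "\<lambda>x. complex_of_real (gauss x) * iexp ((v /\<^sub>R s) \<bullet> x)"
  have f: "?f (0 + s *\<^sub>R x) = complex_of_real (gauss (s *\<^sub>R x)) * iexp (v \<bullet> x)" for x
    using s by (simp add: field_simps)
  have m: "?f \<in> borel_measurable borel"
    by measurable
  have h: "has_bochner_integral lborel ?f (of_real (exp (- (norm (v /\<^sub>R s))\<^sup>2 / 2)))"
    by (rule has_bochner_integral_gauss_iexp)
  show "integrable lborel (\<lambda>x::'a. complex_of_real (gauss (s *\<^sub>R x)) * iexp (v \<bullet> x))"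
    using lborel_integrable_affine[OF _ m, of s 0] h s unfolding f has_bochner_integral_iff by auto
  show "(\<integral>x. complex_of_real (gauss (s *\<^sub>R x)) * iexp (v \<bullet> x) \<partial>lborel) =
         of_real (exp (- (norm (v /\<^sub>R s))\<^sup>2 / 2) / s ^ DIM('a))"
    using lborel_integral_affine[OF _ m, of s 0] h s unfolding f has_bochner_integral_iff
    by (auto simp: field_simps scaleR_conv_of_real)
qed

section \<open>Positive quadratic forms from nonnegative Fourier transforms\<close>

text \<open>Fourier inversion damped by a Gaussian: Fubini moves the transform from \<open>\<Psi>\<close> to the Gaussian,
  where it is explicit. For bounded continuous \<open>\<Psi>\<close> the right-hand side tends to
  \<open>\<Psi> x / gauss 0\<close> as \<open>s \<rightarrow> 0\<close>. The factor \<open>gauss 0\<close>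
  is the usual normalisation \<open>(2\<pi>)\<^bsup>-d\<^esup>\<close> of the inversion formula times the \<open>(2\<pi>)\<^bsup>d/2\<^esup>\<close> from
  normalising the damping.\<close>

lemma
  fixes \<Psi> :: "real^'d \<Rightarrow> real" and x :: "real^'d"
  assumes s: "s > 0" and \<Psi>: "integrable lborel \<Psi>"
  shows integrable_fourier_gauss:
      "integrable lborel (\<lambda>\<xi>. fourier \<Psi> \<xi> * (gauss (s *\<^sub>R \<xi>) * iexp (x \<bullet> \<xi>)))"
    and integral_fourier_gauss:
      "(\<integral>\<xi>. fourier \<Psi> \<xi> * (gauss (s *\<^sub>R \<xi>) * iexp (x \<bullet> \<xi>)) \<partial>lborel) =
         of_real ((\<integral>u. \<Psi> (x + s *\<^sub>R u) * gauss u \<partial>lborel) / gauss (0 :: real^'d))"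
proof -
  let ?w = "\<lambda>\<xi>. complex_of_real (gauss (s *\<^sub>R \<xi>)) * iexp (x \<bullet> \<xi>)"
  let ?h = "\<lambda>\<xi> y. complex_of_real (\<Psi> y) * ?w \<xi> * iexp (- (\<xi> \<bullet> y))"
  let ?P = "lborel \<Otimes>\<^sub>M lborel :: ((real^'d) \<times> (real^'d)) measure"
  have [measurable]: "\<Psi> \<in> borel_measurable borel"
    using \<Psi> by auto
  have w: "integrable lborel ?w"
    by (rule integrable_scaled_gauss_iexp[OF s])
  have "integrable ?P (\<lambda>(\<xi>, y). ?w \<xi> * complex_of_real (\<Psi> y))"
    using w \<Psi> integrable_norm[OF w]
    by (intro lborel_pair.Fubini_integrable) (auto simp: norm_mult)
  then have h: "integrable ?P (case_prod ?h)"
    by (rule Bochner_Integration.integrable_bound) (auto simp: norm_mult)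
  have F: "(\<integral>y. ?h \<xi> y \<partial>lborel) = fourier \<Psi> \<xi> * ?w \<xi>" for \<xi>
    unfolding fourier_def
    by (subst integral_mult_left_zero[symmetric]) (intro Bochner_Integration.integral_cong, auto simp: mult_ac)
  show "integrable lborel (\<lambda>\<xi>. fourier \<Psi> \<xi> * ?w \<xi>)"
    using lborel_pair.integrable_fst[OF h] unfolding F .
  let ?k = "\<lambda>y. \<Psi> y * exp (- (norm ((x - y) /\<^sub>R s))\<^sup>2 / 2)"
  have k: "?k \<in> borel_measurable borel" by measurable
  have "(\<integral>\<xi>. fourier \<Psi> \<xi> * ?w \<xi> \<partial>lborel) = (\<integral>y. (\<integral>\<xi>. ?h \<xi> y \<partial>lborel) \<partial>lborel)"
    using lborel_pair.Fubini_integral[OF h] unfolding F by simp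
  also have "\<dots> = (\<integral>y. complex_of_real (?k y / s ^ CARD('d)) \<partial>lborel)"
  proof (intro Bochner_Integration.integral_cong refl)
    fix y
    have "?h \<xi> y = of_real (\<Psi> y) * (complex_of_real (gauss (s *\<^sub>R \<xi>)) * iexp ((x - y) \<bullet> \<xi>))" for \<xi>
      by (simp add: inner_diff_left inner_commute[of \<xi> y] right_diff_distrib exp_diff exp_minus divide_inverse)
    then have "(\<integral>\<xi>. ?h \<xi> y \<partial>lborel) =
      of_real (\<Psi> y) * (\<integral>\<xi>. complex_of_real (gauss (s *\<^sub>R \<xi>)) * iexp ((x - y) \<bullet> \<xi>) \<partial>lborel)"
      by (simp only: integral_mult_right_zero)
    then show "(\<integral>\<xi>. ?h \<xi> y \<partial>lborel) = complex_of_real (?k y / s ^ CARD('d))"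
      by (simp add: integral_scaled_gauss_iexp[OF s])
  qed
  also have "\<dots> = of_real ((\<integral>y. ?k y \<partial>lborel) / s ^ CARD('d))"
    by (simp del: of_real_mult of_real_divide)
  also have "(\<integral>y. ?k y \<partial>lborel) / s ^ CARD('d) = (\<integral>u. \<Psi> (x + s *\<^sub>R u) * (gauss u / gauss (0::real^'d)) \<partial>lborel)"
    using s by (subst lborel_integral_affine[OF _ k, of s x]) (simp_all add: gauss_divide_gauss_0)
  finally show "(\<integral>\<xi>. fourier \<Psi> \<xi> * ?w \<xi> \<partial>lborel) =
         of_real ((\<integral>u. \<Psi> (x + s *\<^sub>R u) * gauss u \<partial>lborel) / gauss (0 :: real^'d))"
    by simp
qed

lemma mollification_tendsto:
  fixes \<Psi> :: "'a::euclidean_space \<Rightarrow> real"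
  assumes cont: "continuous_on UNIV \<Psi>" and bdd: "\<And>x. \<bar>\<Psi> x\<bar> \<le> B"
  shows "(\<lambda>n. \<integral>u. \<Psi> (x + (1 / real (Suc n)) *\<^sub>R u) * gauss u \<partial>lborel) \<longlonglongrightarrow> \<Psi> x"
proof -
  have [measurable]: "\<Psi> \<in> borel_measurable borel"
    using cont by (rule borel_measurable_continuous_onI)
  have "(\<lambda>n. \<integral>u. \<Psi> (x + (1 / real (Suc n)) *\<^sub>R u) * gauss u \<partial>lborel)
    \<longlonglongrightarrow> (\<integral>u. \<Psi> x * gauss (u::'a) \<partial>lborel)"
  proof (rule integral_dominated_convergence[where w = "\<lambda>u. B * gauss u"])
    show "AE u in lborel. (\<lambda>n. \<Psi> (x + (1 / real (Suc n)) *\<^sub>R u) * gauss u) \<longlonglongrightarrow> \<Psi> x * gauss u"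
    proof (rule AE_I2)
      fix u :: 'a
      have "(\<lambda>n. x + (1 / real (Suc n)) *\<^sub>R u) \<longlonglongrightarrow> x + 0 *\<^sub>R u"
        by (intro tendsto_intros LIMSEQ_Suc[OF lim_1_over_n])
      then show "(\<lambda>n. \<Psi> (x + (1 / real (Suc n)) *\<^sub>R u) * gauss u) \<longlonglongrightarrow> \<Psi> x * gauss u"
        using cont by (intro tendsto_intros continuous_on_tendsto_compose[OF cont]) auto
    qed
    show "AE u in lborel. norm (\<Psi> (x + (1 / real (Suc n)) *\<^sub>R u) * gauss u) \<le> B * gauss u" for n
      using bdd by (auto simp: abs_mult gauss_nonneg intro!: mult_right_mono)
  qed (auto intro: integrable_gauss)
  then show ?thesis
    by (simp add: integral_gauss)
qed

text \<open>The easy half of Bochner's theorem. In the damped inversion formula the exponentials sum to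
  \<open>|S(\<xi>)|\<^sup>2\<close> with \<open>S(\<xi>) = \<Sum>\<^sub>i a\<^sub>i exp (i z\<^sub>i \<bullet> \<xi>)\<close>, so the form of the mollified \<open>\<Psi>\<close> is nonnegative;
  then the mollification width goes to zero.\<close>

lemma quadratic_form_nonneg_of_fourier_nonneg:
  fixes \<Psi> :: "real^'d \<Rightarrow> real" and z :: "'i \<Rightarrow> real^'d" and a :: "'i \<Rightarrow> real"
  assumes \<Psi>: "integrable lborel \<Psi>" "continuous_on UNIV \<Psi>" "\<And>x. \<bar>\<Psi> x\<bar> \<le> B"
    and nonneg: "\<And>\<xi>. 0 \<le> Re (fourier \<Psi> \<xi>)"
  shows "0 \<le> (\<Sum>i\<in>I. \<Sum>j\<in>I. a i * a j * \<Psi> (z i - z j))"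
proof (rule LIMSEQ_le_const)
  let ?M = "\<lambda>x n. \<integral>u. \<Psi> (x + (1 / real (Suc n)) *\<^sub>R u) * gauss u \<partial>lborel"
  show "(\<lambda>n. \<Sum>i\<in>I. \<Sum>j\<in>I. a i * a j * ?M (z i - z j) n) \<longlonglongrightarrow>
      (\<Sum>i\<in>I. \<Sum>j\<in>I. a i * a j * \<Psi> (z i - z j))"
    by (intro tendsto_intros mollification_tendsto[OF \<Psi>(2,3)])
  have "0 \<le> (\<Sum>i\<in>I. \<Sum>j\<in>I. a i * a j * ?M (z i - z j) n)" for n
  proof -
    define s where "s = 1 / real (Suc n)"
    have s: "s > 0" by (simp add: s_def)
    define w where "w = (\<lambda>x \<xi>. fourier \<Psi> \<xi> * (gauss (s *\<^sub>R \<xi>) * iexp (x \<bullet> \<xi>)))"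
    define S where "S \<xi> = (\<Sum>i\<in>I. of_real (a i) * iexp (z i \<bullet> \<xi>))" for \<xi>
    have w: "integrable lborel (w x)"
        "integral\<^sup>L lborel (w x) = of_real (?M x n / gauss (0 :: real^'d))" for x
      using integrable_fourier_gauss[OF s \<Psi>(1), of x] integral_fourier_gauss[OF s \<Psi>(1), of x]
      by (simp_all add: w_def s_def)
    have SS: "(\<Sum>i\<in>I. \<Sum>j\<in>I. of_real (a i * a j) * w (z i - z j) \<xi>) =
        fourier \<Psi> \<xi> * of_real (gauss (s *\<^sub>R \<xi>) * (cmod (S \<xi>))\<^sup>2)" for \<xi>
    proof -
      have "S \<xi> * cnj (S \<xi>) =
          (\<Sum>i\<in>I. \<Sum>j\<in>I. of_real (a i * a j) * iexp ((z i - z j) \<bullet> \<xi>))"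
        by (simp add: S_def sum_product exp_cnj inner_diff_left exp_diff right_diff_distrib
            exp_minus divide_inverse mult_ac)
      then show ?thesis
        unfolding of_real_mult complex_norm_square w_def by (simp add: sum_distrib_left mult_ac)
    qed
    have "0 \<le> (\<integral>\<xi>. Re (\<Sum>i\<in>I. \<Sum>j\<in>I. of_real (a i * a j) * w (z i - z j) \<xi>) \<partial>lborel)"
      unfolding SS using nonneg by (intro Bochner_Integration.integral_nonneg) (simp add: gauss_nonneg)
    also have "\<dots> = Re (\<integral>\<xi>. (\<Sum>i\<in>I. \<Sum>j\<in>I. of_real (a i * a j) * w (z i - z j) \<xi>) \<partial>lborel)"
      by (intro integral_Re Bochner_Integration.integrable_sum integrable_mult_right w)
    also have "\<dots> = Re (\<Sum>i\<in>I. \<Sum>j\<in>I. of_real (a i * a j) * integral\<^sup>L lborel (w (z i - z j)))"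
      by (simp add: Bochner_Integration.integral_sum Bochner_Integration.integrable_sum w(1))
    also have "\<dots> = (\<Sum>i\<in>I. \<Sum>j\<in>I. a i * a j * ?M (z i - z j) n) / gauss (0 :: real^'d)"
      unfolding w(2) by (simp add: sum_divide_distrib)
    finally show ?thesis
      using gauss_0_pos[where 'a="real^'d"] by (simp add: zero_le_divide_iff)
  qed
  then show "\<exists>N. \<forall>n\<ge>N. 0 \<le> (\<Sum>i\<in>I. \<Sum>j\<in>I. a i * a j * ?M (z i - z j) n)"
    by blast
qed

lemma
  fixes \<xi> :: "real^'d"
  assumes s: "s > 0"
  shows integrable_gauss_scaled: "integrable lborel (\<lambda>x::real^'d. gauss (x /\<^sub>R s) / s ^ CARD('d))"
    and fourier_gauss_scaled:
      "fourier (\<lambda>x::real^'d. gauss (x /\<^sub>R s) / s ^ CARD('d)) \<xi> = of_real (exp (- (norm (s *\<^sub>R \<xi>))\<^sup>2 / 2))"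
proof -
  have p: "inverse s > 0" using s by simp
  have "integrable lborel (\<lambda>x::real^'d. gauss (x /\<^sub>R s))"
    using lborel_integrable_affine[of "inverse s" gauss "0::real^'d"] integrable_gauss s by auto
  then show "integrable lborel (\<lambda>x::real^'d. gauss (x /\<^sub>R s) / s ^ CARD('d))"
    by simp
  have "fourier (\<lambda>x::real^'d. gauss (x /\<^sub>R s) / s ^ CARD('d)) \<xi> =
      (\<integral>x. complex_of_real (gauss (x /\<^sub>R s)) * iexp ((-\<xi>) \<bullet> x) / s ^ CARD('d) \<partial>lborel)"
    by (simp add: fourier_def)
  also have "\<dots> = of_real (exp (- (norm (s *\<^sub>R \<xi>))\<^sup>2 / 2))"
    using s by (subst integral_divide_zero, subst integral_scaled_gauss_iexp[OF p]) (simp add: field_simps)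
  finally show "fourier (\<lambda>x::real^'d. gauss (x /\<^sub>R s) / s ^ CARD('d)) \<xi> = of_real (exp (- (norm (s *\<^sub>R \<xi>))\<^sup>2 / 2))" .
qed

lemma integrable_fourier_kernel:
  fixes f :: "real^'d \<Rightarrow> real"
  assumes "integrable lborel f"
  shows "integrable lborel (\<lambda>x. complex_of_real (f x) * exp (- (\<i> * of_real (\<xi> \<bullet> x))))"
proof (rule Bochner_Integration.integrable_bound[where f="f"])
  have [measurable]: "f \<in> borel_measurable borel" using assms by auto
  show "(\<lambda>x. complex_of_real (f x) * exp (- (\<i> * of_real (\<xi> \<bullet> x)))) \<in> borel_measurable lborel"
    by measurable
qed (use assms in \<open>auto simp: norm_mult\<close>)

lemma fourier_diff_cmult:
  fixes f g :: "real^'d \<Rightarrow> real"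
  assumes "integrable lborel f" "integrable lborel g"
  shows "fourier (\<lambda>x. f x - c * g x) \<xi> = fourier f \<xi> - of_real c * fourier g \<xi>"
proof -
  have "fourier (\<lambda>x. f x - c * g x) \<xi> =
    (\<integral>x. of_real (f x) * exp (- (\<i> * of_real (\<xi> \<bullet> x))) -
      of_real c * (of_real (g x) * exp (- (\<i> * of_real (\<xi> \<bullet> x)))) \<partial>lborel)"
    unfolding fourier_def by (intro Bochner_Integration.integral_cong) (auto simp: algebra_simps)
  then show ?thesis
    unfolding fourier_def
    by (simp add: Bochner_Integration.integral_diff integrable_fourier_kernel assms)
qed

text \<open>Apply the preceding nonnegativity to \<open>\<Phi>\<close> minus \<open>A\<close> times the Gaussian density of width \<open>s\<close>,
  whose Fourier transform is \<open>exp (- |s \<xi>|\<^sup>2 / 2)\<close>.\<close>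

lemma quadratic_form_ge_gaussian:
  fixes \<Phi> :: "real^'d \<Rightarrow> real" and z :: "'i \<Rightarrow> real^'d" and a :: "'i \<Rightarrow> real"
  assumes \<Phi>: "integrable lborel \<Phi>" "continuous_on UNIV \<Phi>" "\<And>x. \<bar>\<Phi> x\<bar> \<le> B"
    and s: "s > 0" 
    and ge: "\<And>\<xi>. A * exp (- (norm (s *\<^sub>R \<xi>))\<^sup>2 / 2) \<le> Re (fourier \<Phi> \<xi>)"
  shows "A / s ^ CARD('d) * (\<Sum>i\<in>I. \<Sum>j\<in>I. a i * a j * gauss ((z i - z j) /\<^sub>R s))
    \<le> (\<Sum>i\<in>I. \<Sum>j\<in>I. a i * a j * \<Phi> (z i - z j))"
proof -
  let ?g = "\<lambda>x::real^'d. gauss (x /\<^sub>R s) / s ^ CARD('d)"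
  let ?\<Psi> = "\<lambda>x. \<Phi> x - A * ?g x"
  have "0 \<le> (\<Sum>i\<in>I. \<Sum>j\<in>I. a i * a j * ?\<Psi> (z i - z j))"
  proof (rule quadratic_form_nonneg_of_fourier_nonneg)
    show "integrable lborel ?\<Psi>"
      by (intro Bochner_Integration.integrable_diff integrable_mult_right \<Phi> integrable_gauss_scaled[OF s])
    show "continuous_on UNIV ?\<Psi>"
      using s by (intro continuous_intros \<Phi>) auto
    show "\<bar>?\<Psi> x\<bar> \<le> B + \<bar>A\<bar> * (gauss (0::real^'d) / s ^ CARD('d))" for x
    proof -
      have "gauss (x /\<^sub>R s) \<le> gauss (0::real^'d)"
        unfolding gauss_def by (intro mult_left_mono) auto
      then have "\<bar>A * ?g x\<bar> \<le> \<bar>A\<bar> * (gauss (0::real^'d) / s ^ CARD('d))"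
        unfolding abs_mult using s gauss_nonneg[of "x /\<^sub>R s"]
        by (intro mult_left_mono) (auto simp: divide_right_mono)
      then show ?thesis
        using \<Phi>(3)[of x] by linarith
    qed
    show "0 \<le> Re (fourier ?\<Psi> \<xi>)" for \<xi>
      using ge[of \<xi>]
      by (simp only: fourier_diff_cmult[OF \<Phi>(1) integrable_gauss_scaled[OF s]] fourier_gauss_scaled[OF s]
         flip: of_real_mult) simp
  qed
  also have "\<dots> = (\<Sum>i\<in>I. \<Sum>j\<in>I. a i * a j * \<Phi> (z i - z j)) -
      A / s ^ CARD('d) * (\<Sum>i\<in>I. \<Sum>j\<in>I. a i * a j * gauss ((z i - z j) /\<^sub>R s))"
    unfolding sum_distrib_left sum_subtractf[symmetric]
    by (intro sum.cong refl) (simp add: field_simps)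
  finally show ?thesis by simp
qed

section \<open>Coercivity of the rescaled kernel matrix\<close>

text \<open>Two-point configurations \<open>x, 0\<close> with coefficients \<open>1, \<plusminus>1\<close> give
  \<open>2 \<Phi>(0) \<plusminus> 2 \<Phi>(x) > 0\<close>.\<close>

lemma pos_def_kernel_bounded:
  fixes \<Phi> :: "'a::euclidean_space \<Rightarrow> real"
  assumes "pos_def_kernel (\<lambda>x y. \<Phi> (x - y))"
  shows "\<bar>\<Phi> x\<bar> \<le> \<Phi> 0"
proof -
  have sym: "\<Phi> (u - v) = \<Phi> (v - u)" for u v
    using assms unfolding pos_def_kernel_def by (elim conjE allE)
  have pd: "0 < (\<Sum>i<N. \<Sum>j<N. a i * a j * \<Phi> (z i - z j))"
    if "\<exists>i<N. a i \<noteq> 0" "inj_on z {..<N}" for a z and N :: nat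
    using assms that unfolding pos_def_kernel_def by simp
  show ?thesis
  proof (cases "x = 0")
    case True
    have "0 < \<Phi> 0"
      using pd[of 1 "\<lambda>_. 1" "\<lambda>_. 0"] by (simp add: inj_on_def)
    then show ?thesis
      using True by simp
  next
    case False
    let ?z = "\<lambda>i::nat. if i = 0 then x else 0"
    have two: "{..<2} = {0, 1::nat}"
      by auto
    have inj: "inj_on ?z {..<2}"
      using False by (simp add: inj_on_def two)
    have ex: "\<exists>i<2. b i \<noteq> 0" if "b 0 = 1" for b :: "nat \<Rightarrow> real"
      using that by (intro exI[of _ 0]) simp
    have "0 < 2 * \<Phi> 0 + 2 * \<Phi> x"
      using pd[OF ex inj, of "\<lambda>_. 1"] sym[of 0 x] by (simp add: two)
    moreover have "0 < 2 * \<Phi> 0 - 2 * \<Phi> x"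
      using pd[OF ex inj, of "\<lambda>i. if i = 0 then 1 else -1"] sym[of 0 x] by (simp add: two)
    ultimately show ?thesis by linarith
  qed
qed

text \<open>An algebraic tail dominates an exponential one. The explicit constant comes from \<open>ln u \<le> u\<close> at
  \<open>u = s (1 + r) / \<alpha>\<close>, where the multiple \<open>\<alpha> u\<close> is exactly \<open>s (1 + r)\<close>.\<close>

lemma one_plus_powr_ge_exp:
  fixes \<alpha> s :: real
  assumes \<alpha>: "\<alpha> > 0" and s: "s > 0"
  obtains c where "c > 0" "\<And>r. r \<ge> 0 \<Longrightarrow> c * exp (- s * r) \<le> (1 + r) powr (- \<alpha>)"
proof
  show "exp (- s - \<alpha> * ln (\<alpha> / s)) > 0" by simp
  fix r :: real assume r: "r \<ge> 0"
  let ?u = "s * (1 + r) / \<alpha>"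
  have "ln ?u \<le> ?u"
    using r \<alpha> s by (intro less_imp_le ln_less_self) auto
  moreover have "ln (1 + r) = ln (\<alpha> / s) + ln ?u"
    using r \<alpha> s by (subst ln_mult_pos[symmetric]) auto
  ultimately have "\<alpha> * ln (1 + r) \<le> \<alpha> * (ln (\<alpha> / s) + ?u)"
    using \<alpha> by (intro mult_left_mono) auto
  also have "\<dots> = \<alpha> * ln (\<alpha> / s) + s * (1 + r)"
    using \<alpha> by (simp add: field_simps)
  finally show "exp (- s - \<alpha> * ln (\<alpha> / s)) * exp (- s * r) \<le> (1 + r) powr (- \<alpha>)"
    using r by (simp add: powr_def flip: exp_add) (simp add: algebra_simps)
qed

text \<open>For \<open>t \<rightarrow> \<infinity>\<close> the off-diagonal entries of the Gram matrix tend to zero while the diagonal stays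
  at \<open>gauss 0\<close>. Once each off-diagonal entry is at most \<open>gauss 0 / (2n)\<close>, the inequality
  \<open>2 |a\<^sub>i a\<^sub>j| \<le> a\<^sub>i\<^sup>2 + a\<^sub>j\<^sup>2\<close> charges them to half of the diagonal.\<close>

lemma narrow_gaussian_gram_ge:
  fixes X :: "'n::finite \<Rightarrow> 'a::euclidean_space"
  assumes "inj X"
  obtains t where "t > 0"
    "\<And>a. gauss (0::'a) / 2 * (\<Sum>i\<in>UNIV. (a i)\<^sup>2)
        \<le> (\<Sum>i\<in>UNIV. \<Sum>j\<in>UNIV. a i * a j * gauss (t *\<^sub>R (X i - X j)))"
proof -
  let ?n = "real CARD('n)" and ?G = "gauss (0::'a)"
  have n: "?n > 0" by simp
  have G: "?G > 0" by (rule gauss_0_pos)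
  have lim: "((\<lambda>t. gauss (t *\<^sub>R v)) \<longlongrightarrow> 0) at_top" if "v \<noteq> 0" for v :: 'a
  proof -
    have "((\<lambda>t::real. exp (- (t * norm v)\<^sup>2 / 2)) \<longlongrightarrow> 0) at_top"
      using that by real_asymp
    from tendsto_mult_left[OF this, of ?G] show ?thesis
      by (simp add: gauss_def power_mult_distrib)
  qed
  have "\<forall>\<^sub>F t in at_top. \<forall>i j. i \<noteq> j \<longrightarrow> gauss (t *\<^sub>R (X i - X j)) \<le> ?G / (2 * ?n)"
  proof (intro eventually_all_finite)
    fix i j show "\<forall>\<^sub>F t in at_top. i \<noteq> j \<longrightarrow> gauss (t *\<^sub>R (X i - X j)) \<le> ?G / (2 * ?n)"
    proof (cases "i = j")
      case False
      then have "X i - X j \<noteq> 0" using assms by (auto dest: injD)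
      from order_tendstoD(2)[OF lim[OF this], of "?G / (2 * ?n)"] n G
      show ?thesis by (auto elim!: eventually_mono)
    qed simp
  qed
  then have "\<forall>\<^sub>F t in at_top. t > (0::real) \<and> (\<forall>i j. i \<noteq> j \<longrightarrow> gauss (t *\<^sub>R (X i - X j)) \<le> ?G / (2 * ?n))"
    by (intro eventually_conj eventually_gt_at_top)
  from eventually_happens'[OF trivial_limit_at_top_linorder this]
  obtain t :: real where t: "t > 0"
    and small: "\<And>i j. i \<noteq> j \<Longrightarrow> gauss (t *\<^sub>R (X i - X j)) \<le> ?G / (2 * ?n)"
    by blast
  have "?G / 2 * (\<Sum>i\<in>UNIV. (a i)\<^sup>2)
        \<le> (\<Sum>i\<in>UNIV. \<Sum>j\<in>UNIV. a i * a j * gauss (t *\<^sub>R (X i - X j)))" for a :: "'n \<Rightarrow> real"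
  proof -
    have "(if i = j then ?G * (a i)\<^sup>2 else 0) - ?G / (4 * ?n) * ((a i)\<^sup>2 + (a j)\<^sup>2)
      \<le> a i * a j * gauss (t *\<^sub>R (X i - X j))" for i j
    proof (cases "i = j")
      case False
      have "2 * \<bar>a i * a j\<bar> \<le> (a i)\<^sup>2 + (a j)\<^sup>2"
        using sum_squares_bound[of "\<bar>a i\<bar>" "\<bar>a j\<bar>"] by (simp add: abs_mult)
      then have "\<bar>a i * a j\<bar> * gauss (t *\<^sub>R (X i - X j)) \<le> ((a i)\<^sup>2 + (a j)\<^sup>2) / 2 * (?G / (2 * ?n))"
        using small[OF False] by (intro mult_mono) (auto simp: gauss_nonneg)
      moreover have "- (\<bar>a i * a j\<bar> * gauss (t *\<^sub>R (X i - X j))) \<le> a i * a j * gauss (t *\<^sub>R (X i - X j))"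
        using gauss_nonneg[of "t *\<^sub>R (X i - X j)"]
        by (subst mult_minus_left[symmetric]) (intro mult_right_mono, auto)
      ultimately show ?thesis
        using False by (simp add: mult.commute)
    next
      case True
      have "0 \<le> ?G / (4 * ?n) * ((a i)\<^sup>2 + (a j)\<^sup>2)"
        using n G by simp
      then show ?thesis
        using True by (simp add: power2_eq_square)
    qed
    then have "(\<Sum>i\<in>UNIV. \<Sum>j\<in>UNIV. (if i = j then ?G * (a i)\<^sup>2 else 0) - ?G / (4 * ?n) * ((a i)\<^sup>2 + (a j)\<^sup>2))
      \<le> (\<Sum>i\<in>UNIV. \<Sum>j\<in>UNIV. a i * a j * gauss (t *\<^sub>R (X i - X j)))"
      by (intro sum_mono)
    moreover have "(\<Sum>i\<in>UNIV. \<Sum>j\<in>UNIV. (if i = j then ?G * (a i)\<^sup>2 else 0) - ?G / (4 * ?n) * ((a i)\<^sup>2 + (a j)\<^sup>2))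
      = ?G * (\<Sum>i\<in>UNIV. (a i)\<^sup>2) - ?G / (4 * ?n) * (2 * ?n * (\<Sum>i\<in>UNIV. (a i)\<^sup>2))"
    proof -
      have "(\<Sum>i\<in>UNIV. \<Sum>j\<in>UNIV. (a i)\<^sup>2 + (a j)\<^sup>2) = 2 * ?n * (\<Sum>i\<in>UNIV. (a i)\<^sup>2)"
        by (simp add: sum.distrib sum_distrib_left[symmetric])
      then show ?thesis
        by (simp only: sum_subtractf sum_distrib_left[symmetric]) (simp add: sum_distrib_left)
    qed
    moreover have "\<dots> = ?G / 2 * (\<Sum>i\<in>UNIV. (a i)\<^sup>2)"
      using n by (simp add: field_simps)
    ultimately show ?thesis by simp
  qed
  with t that show ?thesis by blast
qed

text \<open>The rate \<open>\<lambda>\<^bsup>d - 2\<alpha>\<^esup>\<close> has two sources: for \<open>\<lambda> \<ge> 1\<close> the lower bound on the Fourier transform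
  satisfies \<open>(1 + |\<xi>|\<^sup>2)\<^bsup>-\<alpha>\<^esup> \<ge> \<lambda>\<^bsup>-2\<alpha>\<^esup> (1 + |\<xi>/\<lambda>|\<^sup>2)\<^bsup>-\<alpha>\<^esup>\<close>, and a Gaussian of width
  \<open>1 / (t \<lambda>)\<close> in space has height proportional to \<open>\<lambda>\<^bsup>d\<^esup>\<close>.\<close>

lemma scaled_kernel_matrix_coercive:
  fixes \<Phi> :: "real^'d \<Rightarrow> real" and X :: "'n::finite \<Rightarrow> real^'d"
  assumes "inj X" and \<Phi>: "integrable lborel \<Phi>" "continuous_on UNIV \<Phi>" "\<And>x. \<bar>\<Phi> x\<bar> \<le> B"
    and C: "C > 0" and \<alpha>: "\<alpha> > 0"
    and ge: "\<And>\<xi>. C * (1 + (norm \<xi>)\<^sup>2) powr (- \<alpha>) \<le> Re (fourier \<Phi> \<xi>)"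
  obtains c where "c > 0"
    "\<And>l a. l \<ge> 1 \<Longrightarrow> c * l powr (real CARD('d) - 2 * \<alpha>) * (a \<bullet> a)
        \<le> a \<bullet> (kernel_matrix (scaled_kernel \<Phi> l) X *v a)"
proof -
  let ?d = "CARD('d)" and ?G = "gauss (0 :: real^'d)"
  obtain t where t: "t > 0" and gram: "\<And>a. ?G / 2 * (\<Sum>i\<in>UNIV. (a i)\<^sup>2)
        \<le> (\<Sum>i\<in>UNIV. \<Sum>j\<in>UNIV. a i * a j * gauss (t *\<^sub>R (X i - X j)))"
    using narrow_gaussian_gram_ge[OF \<open>inj X\<close>] by blast
  obtain k where k: "k > 0" "\<And>r. r \<ge> 0 \<Longrightarrow> k * exp (- (1 / (2 * t\<^sup>2)) * r) \<le> (1 + r) powr (- \<alpha>)"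
    using one_plus_powr_ge_exp[OF \<alpha>, of "1 / (2 * t\<^sup>2)"] t by auto
  define c where "c = C * k * t ^ ?d * ?G / 2"
  have "c > 0"
    using C k t gauss_0_pos[where 'a="real^'d"] by (simp add: c_def)
  moreover have "c * l powr (real ?d - 2 * \<alpha>) * (a \<bullet> a)
        \<le> a \<bullet> (kernel_matrix (scaled_kernel \<Phi> l) X *v a)" if l: "l \<ge> 1" for l and a :: "real^'n"
  proof -
    \<comment> \<open>With this width the Gaussian sees the points \<open>x\<^sub>i / l\<close> at separation \<open>t (x\<^sub>i - x\<^sub>j)\<close>.\<close>
    define s where "s = 1 / (t * l)"
    define A where "A = C * k * l powr (- 2 * \<alpha>)"
    have s: "s > 0" using t l by (simp add: s_def)
    have A: "A > 0" using C k l by (simp add: A_def)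
    have "A * exp (- (norm (s *\<^sub>R \<xi>))\<^sup>2 / 2) \<le> Re (fourier \<Phi> \<xi>)" for \<xi>
    proof -
      have "k * exp (- (norm (s *\<^sub>R \<xi>))\<^sup>2 / 2) \<le> (1 + (norm \<xi> / l)\<^sup>2) powr (- \<alpha>)"
        using k(2)[of "(norm \<xi> / l)\<^sup>2"] s l t
        by (simp add: s_def power_mult_distrib power_divide mult_ac)
      then have "C * l powr (- 2 * \<alpha>) * (k * exp (- (norm (s *\<^sub>R \<xi>))\<^sup>2 / 2))
        \<le> C * l powr (- 2 * \<alpha>) * (1 + (norm \<xi> / l)\<^sup>2) powr (- \<alpha>)"
        using C by (intro mult_left_mono) auto
      also have "\<dots> = C * (l\<^sup>2 * (1 + (norm \<xi> / l)\<^sup>2)) powr (- \<alpha>)"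
        using l powr_powr[of l 2 "- \<alpha>"] by (simp add: powr_mult)
      also have "\<dots> \<le> C * (1 + (norm \<xi>)\<^sup>2) powr (- \<alpha>)"
      proof (intro mult_left_mono powr_mono2')
        show "1 + (norm \<xi>)\<^sup>2 \<le> l\<^sup>2 * (1 + (norm \<xi> / l)\<^sup>2)"
          using l by (simp add: power_divide distrib_left)
      qed (use C \<alpha> in \<open>auto simp: add_pos_nonneg\<close>)
      also note ge[of \<xi>]
      finally show ?thesis by (simp add: A_def mult_ac)
    qed
    note * = quadratic_form_ge_gaussian[OF \<Phi> s this,
        where I = UNIV and a = "\<lambda>i. a $ i" and z = "\<lambda>i. X i /\<^sub>R l"]
    have le: "A / s ^ ?d * (\<Sum>i\<in>UNIV. \<Sum>j\<in>UNIV. a $ i * a $ j * gauss (t *\<^sub>R (X i - X j)))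
      \<le> (\<Sum>i\<in>UNIV. \<Sum>j\<in>UNIV. a $ i * a $ j * \<Phi> ((X i - X j) /\<^sub>R l))"
    proof -
      have "X i /\<^sub>R l - X j /\<^sub>R l = (X i - X j) /\<^sub>R l" for i j
        by (simp add: scaleR_diff_right)
      moreover have "(x /\<^sub>R l) /\<^sub>R s = t *\<^sub>R x" for x :: "real^'d"
        using l t by (simp add: s_def)
      ultimately show ?thesis
        using * by (simp only:)
    qed
    have "c * l powr (real ?d - 2 * \<alpha>) * (a \<bullet> a) = A / s ^ ?d * (?G / 2 * (\<Sum>i\<in>UNIV. (a $ i)\<^sup>2))"
    proof -
      have "l powr (real ?d - 2 * \<alpha>) = l powr (- 2 * \<alpha>) * l ^ ?d"
        using l powr_add[of l "- 2 * \<alpha>" "real ?d"] by (simp add: powr_realpow)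
      moreover have "1 / s ^ ?d = t ^ ?d * l ^ ?d"
        by (simp add: s_def power_divide power_mult_distrib)
      moreover have "a \<bullet> a = (\<Sum>i\<in>UNIV. (a $ i)\<^sup>2)"
        by (simp add: inner_vec_def power2_eq_square)
      moreover have "A / s ^ ?d = A * (1 / s ^ ?d)"
        by simp
      ultimately show ?thesis
        by (simp only: c_def A_def) (simp add: mult_ac)
    qed
    also have "\<dots> \<le> A / s ^ ?d * (\<Sum>i\<in>UNIV. \<Sum>j\<in>UNIV. a $ i * a $ j * gauss (t *\<^sub>R (X i - X j)))"
      using A s by (intro mult_left_mono gram) auto
    also note le
    also have "(\<Sum>i\<in>UNIV. \<Sum>j\<in>UNIV. a $ i * a $ j * \<Phi> ((X i - X j) /\<^sub>R l)) =
        a \<bullet> (kernel_matrix (scaled_kernel \<Phi> l) X *v a)"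
      by (simp add: inner_vec_def matrix_vector_mult_def kernel_matrix_def scaled_kernel_def
          sum_distrib_left mult_ac)
    finally show ?thesis .
  qed
  ultimately show ?thesis using that by blast
qed

section \<open>Determinants of coercive matrices\<close>

lemma det_nonzero_of_pos_def:
  fixes A :: "real^'n^'n"
  assumes "\<And>x. x \<noteq> 0 \<Longrightarrow> 0 < x \<bullet> (A *v x)"
  shows "det A \<noteq> 0"
proof -
  have "x = 0" if "A *v x = 0" for x
    using assms[of x] that by fastforce
  then have "inj ((*v) A)"
    by (simp add: linear_injective_0)
  then show ?thesis
    by (simp add: invertible_det_nz[symmetric] invertible_left_inverse matrix_left_invertible_injective)
qed

text \<open>The segment from the identity to \<open>A\<close> consists of positive definite matrices, on which the
  determinant is continuous and never zero, so it keeps the sign it has at the identity.\<close>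

lemma det_pos_of_pos_def:
  fixes A :: "real^'n^'n"
  assumes A: "\<And>x. x \<noteq> 0 \<Longrightarrow> 0 < x \<bullet> (A *v x)"
  shows "0 < det A"
proof (rule ccontr)
  assume neg: "\<not> 0 < det A"
  let ?M = "\<lambda>s. (1 - s) *\<^sub>R mat 1 + s *\<^sub>R A"
  have "continuous_on {0..1} (\<lambda>s. det (?M s))"
    unfolding det_def by (intro continuous_intros)
  moreover have "det (?M 1) \<le> 0" "0 \<le> det (?M 0)"
    using neg by simp_all
  ultimately obtain s where s: "0 \<le> s" "s \<le> 1" "det (?M s) = 0"
    using IVT2'[of "\<lambda>s. det (?M s)" 1 0 0] by auto
  have "0 < x \<bullet> (?M s *v x)" if "x \<noteq> 0" for x
  proof (cases "s = 0")
    case False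
    have "x \<bullet> (?M s *v x) = (1 - s) * (x \<bullet> x) + s * (x \<bullet> (A *v x))"
      by (simp add: matrix_vector_mult_add_rdistrib scaleR_matrix_vector_assoc[symmetric] inner_add_right)
    then show ?thesis
      using A[OF that] s False by (simp add: add_nonneg_pos)
  qed (use that in simp)
  then show False
    using det_nonzero_of_pos_def s(3) by blast
qed

lemma abs_det_le:
  fixes A :: "real^'n^'n"
  assumes "\<And>i j. \<bar>A $ i $ j\<bar> \<le> K"
  shows "\<bar>det A\<bar> \<le> fact CARD('n) * K ^ CARD('n)"
proof -
  have "\<bar>det A\<bar> \<le> (\<Sum>p | p permutes (UNIV::'n set). K ^ CARD('n))"
    unfolding det_def
  proof (rule order_trans[OF sum_abs], rule sum_mono)
    fix p
    have "(\<Prod>i\<in>UNIV. \<bar>A $ i $ p i\<bar>) \<le> (\<Prod>i\<in>(UNIV::'n set). K)"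
      using assms by (intro prod_mono) auto
    then show "\<bar>of_int (sign p) * (\<Prod>i\<in>UNIV. A $ i $ p i)\<bar> \<le> K ^ CARD('n)"
      by (simp add: abs_mult abs_prod sign_def)
  qed
  also have "\<dots> = fact CARD('n) * K ^ CARD('n)"
    by (simp add: card_permutations[OF refl])
  finally show ?thesis .
qed

lemma matrix_inv_right:
  fixes A :: "real^'n^'n"
  assumes "det A \<noteq> 0"
  shows "A ** matrix_inv A = mat 1"
proof -
  have "\<exists>A'. A ** A' = mat 1 \<and> A' ** A = mat 1"
    using assms unfolding invertible_det_nz[symmetric] invertible_def .
  from someI_ex[OF this] show ?thesis
    by (simp add: matrix_inv_def)
qed

text \<open>Coercivity bounds the inverse: each of its columns has norm at most \<open>1/c\<close>. The Leibniz formula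
  then bounds the determinant of the inverse from above. The factor \<open>fact n\<close> counts
  the permutations in that formula; it is independent of \<open>c\<close>, so the growth rate in \<open>c\<close> is sharp.\<close>

lemma det_ge_of_coercive:
  fixes A :: "real^'n^'n"
  assumes c: "c > 0" and A: "\<And>x. c * (x \<bullet> x) \<le> x \<bullet> (A *v x)"
  shows "c ^ CARD('n) / fact CARD('n) \<le> det A"
proof -
  have pos: "0 < x \<bullet> (A *v x)" if "x \<noteq> 0" for x
    using A[of x] c that by (smt (verit) inner_gt_zero_iff mult_pos_pos)
  have det: "0 < det A"
    by (rule det_pos_of_pos_def[OF pos])
  then have inv: "A ** matrix_inv A = mat 1"
    by (intro matrix_inv_right) simp
  have "\<bar>matrix_inv A $ i $ j\<bar> \<le> 1 / c" for i j
  proof -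
    let ?x = "matrix_inv A *v axis j 1"
    have Ax: "A *v ?x = axis j 1"
      by (simp add: matrix_vector_mul_assoc inv)
    have "c * (norm ?x)\<^sup>2 \<le> ?x \<bullet> (A *v ?x)"
      using A[of ?x] by (simp add: power2_norm_eq_inner)
    also have "\<dots> \<le> norm ?x"
      unfolding Ax using norm_cauchy_schwarz[of ?x "axis j 1"] by simp
    finally have "c * norm ?x \<le> 1"
      by (cases "norm ?x = 0") (simp_all add: power2_eq_square)
    moreover have "\<bar>?x $ i\<bar> \<le> norm ?x"
      by (rule component_le_norm_cart)
    moreover have "?x $ i = matrix_inv A $ i $ j"
      by (simp add: matrix_vector_mul_component inner_axis)
    ultimately show ?thesis
      using c by (simp add: field_simps) (smt (verit) mult_left_mono)
  qed
  from abs_det_le[OF this]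
  have "\<bar>det (matrix_inv A)\<bar> \<le> fact CARD('n) / c ^ CARD('n)"
    by (simp add: power_one_over)
  moreover have "det A * det (matrix_inv A) = 1"
    using inv by (simp flip: det_mul)
  then have "det (matrix_inv A) = 1 / det A"
    using det by (simp add: field_simps)
  ultimately show ?thesis
    using det c by (simp add: field_simps)
qed

lemma quadratic_form_matrix_inv_nonneg:
  fixes A :: "real^'n^'n"
  assumes pos: "\<And>x. x \<noteq> 0 \<Longrightarrow> 0 < x \<bullet> (A *v x)"
  shows "0 \<le> r \<bullet> (matrix_inv A *v r)"
proof -
  let ?x = "matrix_inv A *v r"
  have "A ** matrix_inv A = mat 1"
    by (rule matrix_inv_right[OF det_nonzero_of_pos_def[OF pos]])
  then have "A *v ?x = r"
    by (simp add: matrix_vector_mul_assoc)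
  then have "r \<bullet> ?x = ?x \<bullet> (A *v ?x)"
    by (simp add: inner_commute)
  then show ?thesis
    using pos[of ?x] by (cases "?x = 0") auto
qed

section \<open>Divergence of the objective and its minimising sequences\<close>

lemma pdf_on_pos_pos_somewhere:
  assumes "pdf_on_pos p"
  obtains l where "l > 0" "p l > 0"
proof -
  have "\<exists>l>0. p l > 0"
  proof (rule ccontr)
    assume neg: "\<not> (\<exists>l>0. p l > 0)"
    have "p l = 0" if "l > 0" for l
    proof (rule antisym)
      show "p l \<le> 0" using neg that by (meson not_less)
      show "0 \<le> p l" using assms that by (simp add: pdf_on_pos_def)
    qed
    then have "(\<lambda>l. indicator {0<..} l *\<^sub>R p l) = (\<lambda>_. 0)"
      by (auto simp: indicator_def fun_eq_iff)
    then show False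
      using assms by (simp add: pdf_on_pos_def set_lebesgue_integral_def)
  qed
  then show ?thesis using that by blast
qed

text \<open>A minimising sequence eventually stays below some real level above the infimum, and the
  objective exceeds that level beyond some \<open>L\<close>; so all but finitely many terms lie in \<open>[0, L]\<close>.\<close>

lemma argmin_finite_of_tendsto_infinity:
  assumes lim: "(f \<longlongrightarrow> \<infinity>) at_top" and l: "l > 0" "f l < \<infinity>"
  shows "argmin_finite f"
  unfolding argmin_finite_def
proof (intro allI impI)
  fix s :: "nat \<Rightarrow> real"
  assume s: "(\<forall>k. 0 < s k) \<and> (\<lambda>k. f (s k)) \<longlonglongrightarrow> (INF l\<in>{0<..}. f l)"
  have "(INF l\<in>{0<..}. f l) \<le> f l"
    using l by (intro INF_lower) auto
  then have "(INF l\<in>{0<..}. f l) < \<infinity>"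
    using l(2) by (rule le_less_trans)
  then obtain c where c: "(INF l\<in>{0<..}. f l) < ereal c"
    using ereal_dense2 by blast
  have "\<forall>\<^sub>F l in at_top. ereal c < f l"
    using lim by (simp add: order_tendstoD(1))
  then obtain L where L: "\<And>l. l \<ge> L \<Longrightarrow> ereal c < f l"
    unfolding eventually_at_top_linorder by blast
  have "\<forall>\<^sub>F k in sequentially. f (s k) < ereal c"
    using s c order_tendstoD(2) by blast
  then obtain N where N: "\<And>k. k \<ge> N \<Longrightarrow> f (s k) < ereal c"
    unfolding eventually_sequentially by blast
  have "s k \<le> L" if "k \<ge> N" for k
    using L[of "s k"] N[OF that] by (meson less_asym linear)
  then have "range s \<subseteq> s ` {..<N} \<union> {0..L}"
  proof (intro image_subsetI)
    fix k show "s k \<in> s ` {..<N} \<union> {0..L}" if "\<And>k. N \<le> k \<Longrightarrow> s k \<le> L"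
      using s that[of k] by (cases "k < N") (auto intro: less_imp_le)
  qed
  then show "bounded (range s)"
    by (rule bounded_subset[rotated]) (auto intro: finite_imp_bounded)
qed

theorem theorem4p1:
  fixes \<Phi> m :: "real^'d \<Rightarrow> real"
    and X :: "'n::finite \<Rightarrow> real^'d"
    and Y :: "real^'n"
    and p :: "real \<Rightarrow> real"
    and C1 C2 \<alpha> :: real
  assumes "inj X"
    and "pos_def_kernel (\<lambda>x y. \<Phi> (x - y))"
    and "continuous_on UNIV \<Phi>"
    and "integrable lborel \<Phi>"
    and "C1 > 0" and "C2 > 0" and "\<alpha> > real CARD('d) / 2"
    and "\<And>\<xi>. C1 * (1 + (norm \<xi>)\<^sup>2) powr (- \<alpha>) \<le> Re (fourier \<Phi> \<xi>)"
    and "\<And>\<xi>. Re (fourier \<Phi> \<xi>) \<le> C2 * (1 + (norm \<xi>)\<^sup>2) powr (- \<alpha>)"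
    and "pdf_on_pos p"
    and "((\<lambda>l. l powr ((\<alpha> - real CARD('d) / 2) * real CARD('n)) * p l) \<longlongrightarrow> 0) at_top"
  shows "(l_MAP \<Phi> m p X Y \<longlongrightarrow> \<infinity>) at_top \<and> argmin_finite (l_MAP \<Phi> m p X Y)"
proof
  let ?d = "real CARD('d)" and ?n = "CARD('n)"
  let ?A = "\<lambda>l. kernel_matrix (scaled_kernel \<Phi> l) X"
  let ?e = "(\<alpha> - ?d / 2) * real ?n"
  have \<alpha>: "\<alpha> > 0"
    using \<open>\<alpha> > ?d / 2\<close> by (smt (verit) divide_nonneg_nonneg of_nat_0_le_iff)
  obtain c where c: "c > 0" and coercive:
    "\<And>l a. l \<ge> 1 \<Longrightarrow> c * l powr (?d - 2 * \<alpha>) * (a \<bullet> a) \<le> a \<bullet> (?A l *v a)"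
    using scaled_kernel_matrix_coercive[OF \<open>inj X\<close> assms(4,3) pos_def_kernel_bounded[OF assms(2)] assms(5) \<alpha> assms(8)]
    by metis
  define b where "b = 1 / 2 * ln (c ^ ?n / fact ?n)"
  have p_nonneg: "0 \<le> p l" if "l > 0" for l
    using assms(10) that by (simp add: pdf_on_pos_def)
  \<comment> \<open>The real constant \<open>b\<close> and the tail of the hyperprior are all that remains of the objective;
    where \<open>p\<close> vanishes both sides are infinite.\<close>
  have lower: "ereal b + neg_log (l powr ?e * p l) \<le> l_MAP \<Phi> m p X Y l" if l: "l \<ge> 1" for l
  proof (cases "p l = 0")
    case True
    then show ?thesis by (simp add: l_MAP_def Let_def neg_log_def)
  next
    case False
    let ?r = "residual m X Y" and ?c = "c * l powr (?d - 2 * \<alpha>)"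
    have p: "p l > 0" using p_nonneg[of l] l False by auto
    have c': "?c > 0" using c l by simp
    have pos: "0 < x \<bullet> (?A l *v x)" if "x \<noteq> 0" for x
      using less_le_trans[OF mult_pos_pos[OF c'] coercive[OF l]] that by simp
    have "ln (?c ^ ?n / fact ?n) \<le> ln (det (?A l))"
      using det_ge_of_coercive[OF c' coercive[OF l]] c' by (intro ln_mono) auto
    moreover have "1 / 2 * ln (?c ^ ?n / fact ?n) = b - ?e * ln l"
      using c l by (simp add: b_def power_mult_distrib ln_mult ln_div ln_powr ln_realpow field_simps)
    moreover have "ln (l powr ?e * p l) = ?e * ln l + ln (p l)"
      using l p by (simp add: ln_mult ln_powr)
    ultimately show ?thesis
      using quadratic_form_matrix_inv_nonneg[OF pos, of ?r] p l
      by (simp add: l_MAP_def Let_def neg_log_def)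
  qed
  show lim: "(l_MAP \<Phi> m p X Y \<longlongrightarrow> \<infinity>) at_top"
    unfolding tendsto_PInfty
  proof
    fix r :: real
    have "\<forall>\<^sub>F l in at_top. l powr ?e * p l < exp (b - r)"
      using assms(11) by (rule order_tendstoD) simp
    then show "\<forall>\<^sub>F l in at_top. ereal r < l_MAP \<Phi> m p X Y l"
      using eventually_ge_at_top[of 1]
    proof eventually_elim
      case (elim l)
      have "ereal r < ereal b + neg_log (l powr ?e * p l)"
      proof (cases "p l = 0")
        case False
        then have "0 < l powr ?e * p l"
          using p_nonneg[of l] elim(2) by simp
        then have "ln (l powr ?e * p l) < b - r"
          using elim(1) by (metis ln_exp ln_less_cancel_iff exp_gt_zero)
        then show ?thesis
          using \<open>0 < l powr ?e * p l\<close> by (simp add: neg_log_def)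
      qed (simp add: neg_log_def)
      also note lower[OF elim(2)]
      finally show ?case .
    qed
  qed
  obtain l where l: "l > 0" "p l > 0"
    using pdf_on_pos_pos_somewhere[OF assms(10)] .
  then have "l_MAP \<Phi> m p X Y l < \<infinity>"
    by (simp add: l_MAP_def Let_def neg_log_def)
  then show "argmin_finite (l_MAP \<Phi> m p X Y)"
    using argmin_finite_of_tendsto_infinity[OF lim l(1)] by blast
qed

end
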